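(* Let $f\colon\mathbb{R}^d\to\mathbb{R}$ be a piecewise affine function given in the min-max form $f(x)=\min_{i\in I}f_i(x)$ for all $x \in \mathbb{R}^d$, where $f_i(x)=\max_{j\in J(i)}(a_{ij}+\langle v_{ij},x\rangle)$ with $a_{ij}\in\mathbb{R}$, $v_{ij}\in\mathbb{R}^d$, $I=\{1,\ldots,\ell\}$, $J(i)=\{1,\ldots,s(i)\}$, and let $f_i^*=\inf_{x\in\mathbb{R}^d}f_i(x)$. Let $S(f)=\{x\in\mathbb{R}^d\mid f(x)\le 0\}$ be nonempty and let $V\subseteq\mathbb{R}^d$ be a closed convex cone. Then for any $i\in I$ such that $f_i^*>0$ the following two conditions are equivalent: 1. $f_i$ is coercive on $V$; 2. $0\in\operatorname{int}\bigl(\operatorname{co}\{v_{ij}\mid j\in J(i)\}+V^*\bigr)$. For $f$ to have an error bound on $V$ it is sufficient that for any $i\in I$ such that $f_i^*>0$ one of these two equivalent conditions holds true. Moreover, these conditions become necessary (i.e. if $f$ has an error bound on $V$, then they hold for every $i\in I$ with $f_i^*>0$) when $0^+S(f)\cap V=\{0\}$.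
   Context: $\mathbb{R}^d$ is equipped with an inner product $\langle\cdot,\cdot\rangle$ and an arbitrary norm $\|\cdot\|$; $\operatorname{dist}(x,Q)=\inf_{y\in Q}\|x-y\|$. A function $f\colon\mathbb{R}^d\to\mathbb{R}$ is piecewise affine if there are finitely many polyhedral sets (finite intersections of closed half-spaces) $Q_1,\ldots,Q_s$ with nonempty, pairwise disjoint interiors covering $\mathbb{R}^d$ and affine functions $F_1,\ldots,F_s$ such that $f=F_k$ on $Q_k$ for each $k$; every such function admits a min-max representation as in the claim, and conversely. The function $f$ has an error bound on $V$ if there exists $\tau>0$ such that $\tau\operatorname{dist}(x,S(f))\le\max\{f(x),0\}$ for all $x\in V$. A function $g$ is coercive on $V$ if $g(x_n)\to+\infty$ for any sequence $\{x_n\}\subset V$ such that $\|x_n\|\to+\infty$ as $n\to\infty$. A cone is a nonempty set $K$ with $tx\in K$ for all $x\in K$, $t\ge 0$. For a convex cone $K$, $K^*=\{y\in\mathbb{R}^d\mid\langle y,x\rangle\le 0\ \forall x\in K\}$ is the polar cone of $K$; $\operatorname{co}$ is the convex hull and $\operatorname{int}$ the topological interior. The recession cone $0^+Q$ of a nonempty set $Q\subseteq\mathbb{R}^d$ is the set of all $z\in\mathbb{R}^d$ for which there exists $x\in Q$ such that $x+\lambda z\in Q$ for all $\lambda\ge 0$. *)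

theory Defs
  imports "HOL-Analysis.Analysis"
begin

text \<open>
  The ambient space is an arbitrary finite-dimensional real inner product space. Its inner
  product is that of class \<^class>\<open>euclidean_space\<close>, whereas distances, error bounds and
  coercivity refer to an arbitrary norm \<open>N\<close>, which need not be induced by the inner product.
\<close>

definition is_norm :: "('a::real_vector \<Rightarrow> real) \<Rightarrow> bool" where
  "is_norm N \<longleftrightarrow>
     (\<forall>x. N x \<ge> 0) \<and>
     (\<forall>x. N x = 0 \<longleftrightarrow> x = 0) \<and>
     (\<forall>c x. N (c *\<^sub>R x) = \<bar>c\<bar> * N x) \<and>
     (\<forall>x y. N (x + y) \<le> N x + N y)"

text \<open>Only meaningful for nonempty \<open>Q\<close>, as the infimum is taken in the reals.\<close>

definition norm_dist :: "('a::real_vector \<Rightarrow> real) \<Rightarrow> 'a \<Rightarrow> 'a set \<Rightarrow> real" where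
  "norm_dist N x Q = (INF y\<in>Q. N (x - y))"

definition affine_fun :: "('a::real_inner \<Rightarrow> real) \<Rightarrow> bool" where
  "affine_fun F \<longleftrightarrow> (\<exists>c w. \<forall>x. F x = c + w \<bullet> x)"

definition piecewise_affine :: "('a::euclidean_space \<Rightarrow> real) \<Rightarrow> bool" where
  "piecewise_affine f \<longleftrightarrow>
     (\<exists>(m::nat) Q F.
        (\<forall>k\<in>{1..m}. polyhedron (Q k) \<and> interior (Q k) \<noteq> {} \<and>
                     affine_fun (F k) \<and> (\<forall>x\<in>Q k. f x = F k x)) \<and>
        disjoint_family_on (\<lambda>k. interior (Q k)) {1..m} \<and>
        (\<Union>k\<in>{1..m}. Q k) = UNIV)"

definition sublevel0 :: "('a \<Rightarrow> real) \<Rightarrow> 'a set" where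
  "sublevel0 f = {x. f x \<le> 0}"

definition has_error_bound_on ::
  "('a::real_vector \<Rightarrow> real) \<Rightarrow> ('a \<Rightarrow> real) \<Rightarrow> 'a set \<Rightarrow> bool" where
  "has_error_bound_on N f V \<longleftrightarrow>
     (\<exists>\<tau>>0. \<forall>x\<in>V. \<tau> * norm_dist N x (sublevel0 f) \<le> max (f x) 0)"

definition coercive_on ::
  "('a::real_vector \<Rightarrow> real) \<Rightarrow> ('a \<Rightarrow> real) \<Rightarrow> 'a set \<Rightarrow> bool" where
  "coercive_on N g V \<longleftrightarrow>
     (\<forall>X::nat \<Rightarrow> 'a. (\<forall>n. X n \<in> V) \<longrightarrow>
        filterlim (\<lambda>n. N (X n)) at_top sequentially \<longrightarrow>
        filterlim (\<lambda>n. g (X n)) at_top sequentially)"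

definition polar_cone :: "'a::real_inner set \<Rightarrow> 'a set" where
  "polar_cone K = {y. \<forall>x\<in>K. y \<bullet> x \<le> 0}"

definition recession_cone :: "'a::real_vector set \<Rightarrow> 'a set" where
  "recession_cone Q = {z. \<exists>x\<in>Q. \<forall>t\<ge>0. x + t *\<^sub>R z \<in> Q}"

end

theory Submission
  imports Defs
begin

text \<open>
  Both conditions on \<open>f\<^sub>i\<close> say that its recession function \<open>max\<^sub>j \<langle>v\<^sub>i\<^sub>j, z\<rangle>\<close> is positive on
  \<open>V - {0}\<close>, hence at least \<open>r |z|\<close> by compactness. For sufficiency, pieces with \<open>f\<^sub>i\<^sup>* \<le> 0\<close> obey
  Hoffman's error bound, while the others are positive and grow linearly on \<open>V\<close>. For necessity, a
  direction of \<open>V\<close> along which some \<open>f\<^sub>i\<close> stays bounded keeps a bounded distance to \<open>S(f)\<close>, so it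
  is a recession direction of \<open>S(f)\<close>.
\<close>

section \<open>Equivalence of \<open>N\<close> with the Euclidean norm, and distances measured in
  \<open>N\<close>\<close>

lemma is_norm_le_norm:
  fixes N :: "'a::euclidean_space \<Rightarrow> real"
  assumes "is_norm N"
  obtains K where "K > 0" "\<And>x. N x \<le> K * norm x"
proof -
  have tri: "N (x + y) \<le> N x + N y" and hom: "N (c *\<^sub>R x) = \<bar>c\<bar> * N x"
    and nonneg: "N x \<ge> 0" and zero: "N 0 = 0" for x y c
    using assms by (auto simp: is_norm_def)
  have sum: "N (\<Sum>b\<in>B. g b) \<le> (\<Sum>b\<in>B. N (g b))" if "finite B" for B and g :: "'a \<Rightarrow> 'a"
    using that
  proof (induction B)
    case (insert b B)
    then show ?case using tri[of "g b" "sum g B"] by simp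
  qed (simp add: zero)
  \<comment> \<open>Adding 1 makes the constant positive from \<open>N b \<ge> 0\<close>
    alone.\<close>
  have "N x \<le> ((\<Sum>b\<in>Basis. N b) + 1) * norm x" for x
  proof -
    have "N x = N (\<Sum>b\<in>Basis. (x \<bullet> b) *\<^sub>R b)" by (simp add: euclidean_representation)
    also have "\<dots> \<le> (\<Sum>b\<in>Basis. N ((x \<bullet> b) *\<^sub>R b))" by (rule sum) simp
    also have "\<dots> \<le> (\<Sum>b\<in>Basis. norm x * N b)"
      by (intro sum_mono) (auto simp: hom intro!: mult_right_mono nonneg Basis_le_norm)
    also have "\<dots> = (\<Sum>b\<in>Basis. N b) * norm x" by (simp add: sum_distrib_left mult.commute)
    finally show ?thesis by (simp add: distrib_right add_increasing2)
  qed
  moreover have "(\<Sum>b\<in>Basis. N b) + 1 > 0"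
    by (simp add: add_nonneg_pos sum_nonneg nonneg)
  ultimately show ?thesis using that by blast
qed

text \<open>By the previous bound \<open>N\<close> is Lipschitz, so it attains a minimum on the
  compact unit sphere, which is positive; homogeneity carries this to all vectors.\<close>

lemma norm_le_is_norm:
  fixes N :: "'a::euclidean_space \<Rightarrow> real"
  assumes "is_norm N"
  obtains K where "K > 0" "\<And>x. norm x \<le> K * N x"
proof -
  have tri: "N (x + y) \<le> N x + N y" and hom: "N (c *\<^sub>R x) = \<bar>c\<bar> * N x"
    and nonneg: "N x \<ge> 0" and pos: "N x = 0 \<longleftrightarrow> x = 0" for x y c
    using assms by (auto simp: is_norm_def)
  obtain K where K: "K > 0" "\<And>x. N x \<le> K * norm x"
    using is_norm_le_norm[OF assms] by blast
  have sym: "N (x - y) = N (y - x)" for x y using hom[of "-1" "y - x"] by simp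
  have "\<bar>N x - N y\<bar> \<le> K * dist x y" for x y
    using tri[of "x - y" y] tri[of "y - x" x] sym[of x y] K(2)[of "x - y"] by (simp add: dist_norm)
  then have "K-lipschitz_on UNIV N"
    using K(1) by (intro lipschitz_onI) (auto simp: dist_real_def)
  then have "continuous_on (sphere 0 1) N"
    by (meson continuous_on_subset lipschitz_on_continuous_on subset_UNIV)
  moreover have "sphere (0::'a) 1 \<noteq> {}" by simp
  ultimately obtain u where u: "u \<in> sphere 0 1" "\<And>y. y \<in> sphere 0 1 \<Longrightarrow> N u \<le> N y"
    using continuous_attains_inf[OF compact_sphere, of 0 1 N] by metis
  have Nu: "N u > 0" using u(1) nonneg[of u] pos[of u] by (cases "u = 0") auto
  have "norm x \<le> inverse (N u) * N x" for x
  proof (cases "x = 0")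
    case False
    then have "N u \<le> N ((1 / norm x) *\<^sub>R x)" by (intro u(2)) simp
    then show ?thesis using False Nu by (simp add: hom field_simps)
  qed (use pos[of 0] in simp)
  then show ?thesis using that[of "inverse (N u)"] Nu by simp
qed

lemma norm_dist_le:
  assumes "is_norm N" "y \<in> Q"
  shows "norm_dist N x Q \<le> N (x - y)"
  unfolding norm_dist_def using assms
  by (intro cINF_lower bdd_belowI[of _ 0]) (auto simp: is_norm_def)

lemma norm_dist_nonneg:
  assumes "is_norm N" "Q \<noteq> {}"
  shows "norm_dist N x Q \<ge> 0"
  unfolding norm_dist_def using assms by (intro cINF_greatest) (auto simp: is_norm_def)

text \<open>An infimum over an arbitrary \<open>Q\<close> need not be attained, so near-minimal
  points stand in for projections.\<close>

lemma norm_dist_approx: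
  assumes "Q \<noteq> {}" "norm_dist N x Q < M"
  obtains y where "y \<in> Q" "N (x - y) < M"
proof -
  have "\<not> (\<forall>y\<in>Q. M \<le> N (x - y))"
    using assms cINF_greatest[of Q M "\<lambda>y. N (x - y)"] by (auto simp: norm_dist_def)
  then show ?thesis using that by force
qed

section \<open>Maxima of finitely many affine functions and their Hoffman error bound\<close>

text \<open>The shape of the pieces \<open>fi i\<close>, over an arbitrary index set. With
  \<open>a = 0\<close> this is the recession function, that is, the support function of the convex
  hull of the \<open>v j\<close>.\<close>

definition max_affine :: "('i \<Rightarrow> real) \<Rightarrow> ('i \<Rightarrow> 'a::real_inner) \<Rightarrow> 'i set \<Rightarrow> 'a \<Rightarrow> real" where
  "max_affine a v J x = Max ((\<lambda>j. a j + v j \<bullet> x) ` J)"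

lemma max_affine_le_iff:
  assumes "finite J" "J \<noteq> {}"
  shows "max_affine a v J x \<le> c \<longleftrightarrow> (\<forall>j\<in>J. a j + v j \<bullet> x \<le> c)"
  using assms by (simp add: max_affine_def)

lemma max_affine_ge:
  assumes "finite J" "j \<in> J"
  shows "a j + v j \<bullet> x \<le> max_affine a v J x"
  using assms by (auto simp: max_affine_def)

lemma max_affine_attained:
  assumes "finite J" "J \<noteq> {}"
  obtains j where "j \<in> J" "max_affine a v J x = a j + v j \<bullet> x"
proof -
  have "max_affine a v J x \<in> (\<lambda>j. a j + v j \<bullet> x) ` J"
    unfolding max_affine_def using assms by (intro Max_in) auto
  then show ?thesis using that by blast
qed

lemma continuous_on_max_affine:
  assumes "finite J" "J \<noteq> {}"
  shows "continuous_on X (max_affine a v J)"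
  using assms
proof (induction J rule: finite_ne_induct)
  case (singleton j)
  show ?case by (simp add: max_affine_def[abs_def] continuous_intros)
next
  case (insert j J)
  have "max_affine a v (insert j J) = (\<lambda>x. max (a j + v j \<bullet> x) (max_affine a v J x))"
    using insert by (auto simp: max_affine_def fun_eq_iff)
  then show ?case using insert by (auto intro!: continuous_intros)
qed

text \<open>Minimise \<open>max h 0\<close> plus a small multiple of the distance to \<open>x\<close>. At a minimiser with
  positive value any point of smaller value gives a common descent direction for the active
  pieces; as there are finitely many active sets, the descent rate is bounded away from 0.\<close>

lemma max_affine_error_bound:
  fixes v :: "'i \<Rightarrow> 'a::euclidean_space"
  assumes J: "finite J" "J \<noteq> {}"
    and inf: "\<And>e. e > 0 \<Longrightarrow> \<exists>w. max_affine a v J w < e"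
  obtains c where "c > 0"
    "\<And>x. \<exists>y. max_affine a v J y \<le> 0 \<and> c * norm (x - y) \<le> max (max_affine a v J x) 0"
proof -
  define h where "h = max_affine a v J"
  \<comment> \<open>\<open>D\<close> collects the candidates for active sets: index sets whose
    linear parts all decrease along a common direction.\<close>
  define D where "D = {A \<in> Pow J. \<exists>u. \<forall>j\<in>A. v j \<bullet> u < 0}"
  have "\<exists>c>0. \<exists>u. norm u \<le> 1 \<and> (\<forall>j\<in>A. v j \<bullet> u \<le> - c)" if A: "A \<in> D" for A
  proof -
    obtain u where u: "\<forall>j\<in>A. v j \<bullet> u < 0" using A by (auto simp: D_def)
    have fin: "finite A" using A J(1) by (auto simp: D_def intro: finite_subset)
    \<comment> \<open>Dividing by \<open>1 + norm u\<close> puts the direction into the unit ball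
      even for \<open>u = 0\<close>, and \<open>insert 1\<close> keeps the minimum defined when
      \<open>A\<close> is empty.\<close>
    define u' where "u' = (1 / (1 + norm u)) *\<^sub>R u"
    define c where "c = Min (insert 1 ((\<lambda>j. - (v j \<bullet> u')) ` A))"
    have pos: "1 + norm u > 0" by (simp add: add_pos_nonneg)
    then have "norm u' \<le> 1" by (simp add: u'_def pos_divide_le_eq)
    moreover have "v j \<bullet> u' < 0" if "j \<in> A" for j
      using u that pos by (simp add: u'_def divide_neg_pos)
    then have "c > 0" using fin by (auto simp: c_def)
    moreover have "v j \<bullet> u' \<le> - c" if "j \<in> A" for j
    proof -
      have "c \<le> - (v j \<bullet> u')" unfolding c_def using fin that by (intro Min_le) auto
      then show ?thesis by simp
    qed
    ultimately show ?thesis by blast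
  qed
  then obtain r where r: "\<And>A. A \<in> D \<Longrightarrow> r A > 0"
      "\<And>A. A \<in> D \<Longrightarrow> \<exists>u. norm u \<le> 1 \<and> (\<forall>j\<in>A. v j \<bullet> u \<le> - r A)"
    by metis
  define c where "c = Min (insert 1 (r ` D))"
  have finD: "finite D" using J(1) by (simp add: D_def)
  have c: "c > 0" using finD r(1) by (auto simp: c_def)
  have cD: "\<exists>u. norm u \<le> 1 \<and> (\<forall>j\<in>A. v j \<bullet> u \<le> - c)" if "A \<in> D" for A
  proof -
    have "c \<le> r A" using finD that by (simp add: c_def)
    then show ?thesis using r(2)[OF that] by force
  qed
  have "\<exists>y. h y \<le> 0 \<and> c / 2 * norm (x - y) \<le> max (h x) 0" for x
  proof -
    \<comment> \<open>The penalty slope is half the rate \<open>c\<close>: a short step of length at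
      most \<open>t\<close> along a descent direction lowers \<open>h\<close> by at least
      \<open>t * c\<close> but raises the penalty by at most \<open>t * c / 2\<close>.\<close>
    define \<phi> where "\<phi> y = max (h y) 0 + c / 2 * norm (x - y)" for y
    \<comment> \<open>Beyond radius \<open>R\<close> the penalty alone exceeds
      \<open>\<phi> x\<close>, so a minimiser over the compact ball is a global one.\<close>
    define R where "R = max (h x) 0 / (c / 2)"
    have "continuous_on (cball x R) \<phi>"
      unfolding \<phi>_def h_def by (intro continuous_intros continuous_on_max_affine J)
    moreover have "R \<ge> 0" using c by (simp add: R_def)
    ultimately obtain y where y: "y \<in> cball x R" "\<And>z. z \<in> cball x R \<Longrightarrow> \<phi> y \<le> \<phi> z"
      using continuous_attains_inf[OF compact_cball, of x R \<phi>] by force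
    have yx: "\<phi> y \<le> \<phi> x" using y(2)[of x] \<open>R \<ge> 0\<close> by simp
    have ymin: "\<phi> y \<le> \<phi> z" for z
    proof (cases "z \<in> cball x R")
      case False
      then have "max (h x) 0 < c / 2 * norm (x - z)"
        using c by (simp add: R_def dist_norm field_simps)
      moreover have "c / 2 * norm (x - z) \<le> \<phi> z" "\<phi> x = max (h x) 0" by (simp_all add: \<phi>_def)
      ultimately have "\<phi> x < \<phi> z" by linarith
      then show ?thesis using yx by linarith
    qed (use y in blast)
    have "h y \<le> 0"
    proof (rule ccontr)
      assume "\<not> h y \<le> 0"
      then have hy: "h y > 0" by simp
      define A where "A = {j \<in> J. a j + v j \<bullet> y = h y}"
      obtain w where w: "h w < h y" using inf[OF hy] by (auto simp: h_def)
      have "v j \<bullet> (w - y) < 0" if "j \<in> A" for j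
        using that w max_affine_ge[OF J(1), of j a v w] by (auto simp: A_def h_def inner_diff_right)
      then have "A \<in> D" by (auto simp: D_def A_def)
      then obtain u where u: "norm u \<le> 1" "\<And>j. j \<in> A \<Longrightarrow> v j \<bullet> u \<le> - c" using cD by metis
      \<comment> \<open>For small \<open>t > 0\<close>, active pieces fall at rate \<open>c\<close>;
        inactive ones are strictly below \<open>h y\<close> at \<open>y\<close> and by continuity
        stay below \<open>h y - t * c\<close>.\<close>
      have "eventually (\<lambda>t. a j + v j \<bullet> (y + t *\<^sub>R u) \<le> h y - t * c) (at_right 0)" if "j \<in> J" for j
      proof (cases "j \<in> A")
        case True
        show ?thesis using eventually_at_right_less[of "0::real"]
        proof eventually_elim
          case (elim t)
          have "t * (v j \<bullet> u) \<le> t * (- c)" using elim u(2)[OF True] by (intro mult_left_mono) auto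
          then show ?case using True by (simp add: A_def inner_add_right)
        qed
      next
        case False
        have "a j + v j \<bullet> y < h y"
          using False that max_affine_ge[OF J(1), of j a v y] by (auto simp: A_def h_def)
        moreover have "((\<lambda>t. a j + v j \<bullet> (y + t *\<^sub>R u) - (h y - t * c)) \<longlongrightarrow>
            a j + v j \<bullet> (y + 0 *\<^sub>R u) - (h y - 0 * c)) (at_right 0)"
          by (intro tendsto_intros)
        ultimately have "eventually (\<lambda>t. a j + v j \<bullet> (y + t *\<^sub>R u) - (h y - t * c) < 0) (at_right 0)"
          by (intro order_tendstoD(2)) auto
        then show ?thesis by eventually_elim simp
      qed
      then have ev: "eventually (\<lambda>t. \<forall>j\<in>J. a j + v j \<bullet> (y + t *\<^sub>R u) \<le> h y - t * c) (at_right 0)"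
        using J(1) by (simp add: eventually_ball_finite_distrib)
      \<comment> \<open>While \<open>h y - t * c\<close> is positive, it bounds the positive part of
        \<open>h\<close> at the new point as well.\<close>
      have ev0: "eventually (\<lambda>t. h y - t * c > 0) (at_right 0)"
        by (rule order_tendstoD(1)[of _ "h y - 0 * c"]) (use hy in \<open>auto intro!: tendsto_eq_intros\<close>)
      have "eventually (\<lambda>t. 0 < t \<and> h y - t * c > 0 \<and> h (y + t *\<^sub>R u) \<le> h y - t * c) (at_right 0)"
        using ev ev0 eventually_at_right_less[of "0::real"]
        by eventually_elim (simp add: h_def max_affine_le_iff[OF J])
      then obtain t where t: "0 < t" "h y - t * c > 0" "h (y + t *\<^sub>R u) \<le> h y - t * c"
        using eventually_happens' trivial_limit_at_right_real by blast
      have "norm (x - (y + t *\<^sub>R u)) \<le> norm (x - y) + norm (t *\<^sub>R u)"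
        using norm_triangle_ineq4[of "x - y" "t *\<^sub>R u"] by (simp add: algebra_simps)
      also have "norm (t *\<^sub>R u) \<le> t" using t(1) u(1) by (simp add: mult_left_le)
      finally have "c / 2 * norm (x - (y + t *\<^sub>R u)) \<le> c / 2 * (norm (x - y) + t)"
        using c by (intro mult_left_mono) auto
      moreover have "max (h (y + t *\<^sub>R u)) 0 \<le> h y - t * c" using t by simp
      moreover have "c * t > 0" using c t(1) by simp
      ultimately have "\<phi> (y + t *\<^sub>R u) < \<phi> y" using hy by (simp add: \<phi>_def algebra_simps)
      then show False using ymin[of "y + t *\<^sub>R u"] by linarith
    qed
    \<comment> \<open>Since \<open>h y \<le> 0\<close>, \<open>\<phi> y\<close> is the penalty
      alone, and \<open>\<phi> x = max (h x) 0\<close>.\<close>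
    moreover have "c / 2 * norm (x - y) \<le> max (h x) 0"
      using yx \<open>h y \<le> 0\<close> by (simp add: \<phi>_def)
    ultimately show ?thesis by blast
  qed
  then show ?thesis using that[of "c / 2"] c by (simp add: h_def)
qed

section \<open>Linear growth on cones and coercivity\<close>

text \<open>On the compact set \<open>V \<inter> sphere 0 1\<close> the recession function attains a
  positive minimum \<open>r\<close> (any \<open>r > 0\<close> will do if the set is empty), and
  homogeneity spreads the bound over the cone.\<close>

lemma pos_imp_linear_growth:
  fixes v :: "'i \<Rightarrow> 'a::euclidean_space"
  assumes J: "finite J" "J \<noteq> {}" and V: "closed V" "cone V"
    and pos: "\<And>z. z \<in> V \<Longrightarrow> z \<noteq> 0 \<Longrightarrow> \<exists>j\<in>J. v j \<bullet> z > 0"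
  obtains r where "r > 0" "\<And>x. x \<in> V \<Longrightarrow> \<exists>j\<in>J. r * norm x \<le> v j \<bullet> x"
proof -
  define g where "g = max_affine (\<lambda>_. 0) v J"
  have "\<exists>r>0. \<forall>u\<in>V \<inter> sphere 0 1. r \<le> g u"
  proof (cases "V \<inter> sphere 0 1 = {}")
    case True
    then show ?thesis by (intro exI[of _ 1]) auto
  next
    case False
    have "compact (V \<inter> sphere 0 1)" using V(1) by (intro closed_Int_compact) auto
    moreover have "continuous_on (V \<inter> sphere 0 1) g"
      unfolding g_def by (rule continuous_on_max_affine[OF J])
    ultimately obtain u where u: "u \<in> V \<inter> sphere 0 1" "\<forall>y\<in>V \<inter> sphere 0 1. g u \<le> g y"
      using continuous_attains_inf[of "V \<inter> sphere 0 1" g] False by blast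
    then obtain j where "j \<in> J" "v j \<bullet> u > 0" using pos[of u] by fastforce
    then have "g u > 0" using max_affine_ge[OF J(1), of j "\<lambda>_. 0" v u] by (simp add: g_def)
    then show ?thesis using u(2) by blast
  qed
  then obtain r where r: "r > 0" "\<And>u. u \<in> V \<inter> sphere 0 1 \<Longrightarrow> r \<le> g u" by blast
  have "\<exists>j\<in>J. r * norm x \<le> v j \<bullet> x" if "x \<in> V" for x
  proof (cases "x = 0")
    case False
    obtain j where j: "j \<in> J" "g ((1 / norm x) *\<^sub>R x) = 0 + v j \<bullet> ((1 / norm x) *\<^sub>R x)"
      using max_affine_attained[OF J] unfolding g_def by metis
    have "(1 / norm x) *\<^sub>R x \<in> V" using V(2) that by (simp add: cone_def)
    then have "r \<le> v j \<bullet> ((1 / norm x) *\<^sub>R x)" using r(2) j(2) False by fastforce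
    then show ?thesis using False j(1) by (auto simp: field_simps)
  qed (use J(2) in auto)
  then show ?thesis using that r(1) by blast
qed

text \<open>The constants \<open>a j\<close> change the recession function by at most the sum of
  their absolute values.\<close>

lemma max_affine_ge_linear_growth:
  assumes J: "finite J" "J \<noteq> {}" and growth: "\<And>x. x \<in> V \<Longrightarrow> \<exists>j\<in>J. r * norm x \<le> v j \<bullet> x"
  obtains A where "A \<ge> 0" "\<And>x. x \<in> V \<Longrightarrow> r * norm x - A \<le> max_affine a v J x"
proof -
  have "r * norm x - (\<Sum>j\<in>J. \<bar>a j\<bar>) \<le> max_affine a v J x" if x: "x \<in> V" for x
  proof -
    obtain j where j: "j \<in> J" "r * norm x \<le> v j \<bullet> x" using growth[OF x] by blast
    have "\<bar>a j\<bar> \<le> (\<Sum>j\<in>J. \<bar>a j\<bar>)" using J(1) j(1) by (intro member_le_sum) auto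
    then show ?thesis using j max_affine_ge[OF J(1) j(1), of a v x] by linarith
  qed
  then show ?thesis using that[of "\<Sum>j\<in>J. \<bar>a j\<bar>"] by (simp add: sum_nonneg)
qed

lemma max_affine_bounded_on_ray:
  assumes J: "finite J" "J \<noteq> {}" and z: "\<And>j. j \<in> J \<Longrightarrow> v j \<bullet> z \<le> 0"
  obtains A where "A \<ge> 0" "\<And>t. t \<ge> 0 \<Longrightarrow> max_affine a v J (t *\<^sub>R z) \<le> A"
proof -
  have "a j + v j \<bullet> (t *\<^sub>R z) \<le> (\<Sum>j\<in>J. \<bar>a j\<bar>)" if "t \<ge> 0" "j \<in> J" for t j
  proof -
    have "\<bar>a j\<bar> \<le> (\<Sum>j\<in>J. \<bar>a j\<bar>)" using J(1) that(2) by (intro member_le_sum) auto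
    moreover have "t * (v j \<bullet> z) \<le> 0" using z that by (simp add: mult_nonneg_nonpos)
    ultimately show ?thesis by simp
  qed
  then show ?thesis using that[of "\<Sum>j\<in>J. \<bar>a j\<bar>"] by (simp add: sum_nonneg max_affine_le_iff[OF J])
qed

text \<open>Coercivity fails along the multiples \<open>n z\<close> of a nonzero \<open>z\<close>
  with all slopes nonpositive: \<open>N (n z)\<close> tends to infinity while the values stay
  bounded. Conversely, linear growth in \<open>norm\<close> is linear growth in \<open>N\<close>, up
  to a factor.\<close>

lemma coercive_on_max_affine_iff:
  fixes v :: "'i \<Rightarrow> 'a::euclidean_space"
  assumes N: "is_norm N" and J: "finite J" "J \<noteq> {}" and V: "closed V" "cone V"
  shows "coercive_on N (max_affine a v J) V \<longleftrightarrow> (\<forall>z\<in>V. z \<noteq> 0 \<longrightarrow> (\<exists>j\<in>J. v j \<bullet> z > 0))"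
proof (intro iffI ballI impI)
  fix z assume coercive: "coercive_on N (max_affine a v J) V" and z: "z \<in> V" "z \<noteq> 0"
  show "\<exists>j\<in>J. v j \<bullet> z > 0"
  proof (rule ccontr)
    assume "\<not> ?thesis"
    then have "\<And>j. j \<in> J \<Longrightarrow> v j \<bullet> z \<le> 0" by force
    then obtain A where A: "\<And>t. t \<ge> 0 \<Longrightarrow> max_affine a v J (t *\<^sub>R z) \<le> A"
      using max_affine_bounded_on_ray[OF J] by metis
    have "N z > 0" using N z(2) by (simp add: is_norm_def less_le)
    then have "filterlim (\<lambda>n. N z * real n) at_top sequentially"
      by (intro filterlim_tendsto_pos_mult_at_top[OF tendsto_const] filterlim_real_sequentially)
    then have "filterlim (\<lambda>n. N (real n *\<^sub>R z)) at_top sequentially"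
      using N by (simp add: is_norm_def mult.commute)
    moreover have "\<And>n. real n *\<^sub>R z \<in> V" using V(2) z(1) by (simp add: cone_def)
    ultimately have "filterlim (\<lambda>n. max_affine a v J (real n *\<^sub>R z)) at_top sequentially"
      using coercive by (simp add: coercive_on_def)
    then have "eventually (\<lambda>n. max_affine a v J (real n *\<^sub>R z) > A) sequentially"
      by (simp add: filterlim_at_top_dense)
    then obtain n where "max_affine a v J (real n *\<^sub>R z) > A"
      using eventually_happens' sequentially_bot by blast
    then show False using A[of "real n"] by simp
  qed
next
  assume "\<forall>z\<in>V. z \<noteq> 0 \<longrightarrow> (\<exists>j\<in>J. v j \<bullet> z > 0)"
  then obtain r where r: "r > 0" "\<And>x. x \<in> V \<Longrightarrow> \<exists>j\<in>J. r * norm x \<le> v j \<bullet> x"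
    using pos_imp_linear_growth[OF J V, of v] by metis
  then obtain A where A: "\<And>x. x \<in> V \<Longrightarrow> r * norm x - A \<le> max_affine a v J x"
    using max_affine_ge_linear_growth[OF J] by metis
  obtain K where K: "K > 0" "\<And>x. N x \<le> K * norm x" using is_norm_le_norm[OF N] by blast
  show "coercive_on N (max_affine a v J) V"
    unfolding coercive_on_def
  proof (intro allI impI)
    fix X :: "nat \<Rightarrow> 'a"
    assume X: "\<forall>n. X n \<in> V" and lim: "filterlim (\<lambda>n. N (X n)) at_top sequentially"
    have "filterlim (\<lambda>n. - A + r / K * N (X n)) at_top sequentially"
      using r(1) K(1)
      by (intro filterlim_tendsto_add_at_top[OF tendsto_const]
          filterlim_tendsto_pos_mult_at_top[OF tendsto_const] lim) auto
    moreover have "- A + r / K * N (X n) \<le> max_affine a v J (X n)" for n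
    proof -
      have "r / K * N (X n) \<le> r / K * (K * norm (X n))"
        using r(1) K by (intro mult_left_mono) auto
      then show ?thesis using A[of "X n"] X K(1) by simp
    qed
    ultimately show "filterlim (\<lambda>n. max_affine a v J (X n)) at_top sequentially"
      by (rule filterlim_at_top_mono[OF _ always_eventually[OF allI]])
  qed
qed

section \<open>Polar cones and the interior condition\<close>

text \<open>The nontrivial half of the bipolar theorem: a hyperplane strictly separating
  \<open>z\<close> from \<open>V\<close> would have its negated normal in the polar cone.\<close>

lemma polar_polar_subset:
  fixes V :: "'a::euclidean_space set"
  assumes V: "V \<noteq> {}" "closed V" "convex V" "cone V"
    and z: "\<And>y. y \<in> polar_cone V \<Longrightarrow> z \<bullet> y \<le> 0"
  shows "z \<in> V"
proof (rule ccontr)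
  assume "z \<notin> V"
  then obtain w b where w: "w \<bullet> z < b" "\<forall>x\<in>V. b < w \<bullet> x"
    using separating_hyperplane_closed_point[OF V(3,2)] by blast
  have "b < 0" using w(2) V(1,4) cone_contains_0 by fastforce
  \<comment> \<open>Otherwise the factor \<open>b / (w \<bullet> x)\<close> scales \<open>x\<close>
    inside the cone to value exactly \<open>b\<close>, against the strict bound.\<close>
  have "w \<bullet> x \<ge> 0" if "x \<in> V" for x
  proof (rule ccontr)
    assume "\<not> ?thesis"
    then have "w \<bullet> ((b / (w \<bullet> x)) *\<^sub>R x) = b" "b / (w \<bullet> x) \<ge> 0"
      using \<open>b < 0\<close> by (auto simp: divide_nonpos_neg)
    then show False using w(2) V(4) that by (metis less_irrefl mem_cone)
  qed
  then have "- w \<in> polar_cone V" by (simp add: polar_cone_def)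
  then show False using z[of "- w"] w(1) \<open>b < 0\<close> by (simp add: inner_commute)
qed

text \<open>Forward, a positive multiple of \<open>z\<close> lies in the sum, yet pairing with
  \<open>z\<close> is nonpositive on both summands if no \<open>v j\<close> is positive on
  \<open>z\<close>. Backward, a point of \<open>ball 0 r\<close> outside the sum is separated by
  some \<open>w\<close>; scaling within the polar cone forces \<open>- w \<in> V\<close>, where
  linear growth contradicts the separation.\<close>

lemma zero_in_interior_hull_plus_polar_iff:
  fixes v :: "'i \<Rightarrow> 'a::euclidean_space"
  assumes J: "finite J" "J \<noteq> {}" and V: "V \<noteq> {}" "closed V" "convex V" "cone V"
  shows "0 \<in> interior (convex hull (v ` J) + polar_cone V)
    \<longleftrightarrow> (\<forall>z\<in>V. z \<noteq> 0 \<longrightarrow> (\<exists>j\<in>J. v j \<bullet> z > 0))"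
proof (intro iffI ballI impI)
  fix z assume "0 \<in> interior (convex hull (v ` J) + polar_cone V)" and z: "z \<in> V" "z \<noteq> 0"
  then obtain e where e: "e > 0" "cball 0 e \<subseteq> convex hull (v ` J) + polar_cone V"
    by (auto simp: mem_interior_cball)
  have "(e / norm z) *\<^sub>R z \<in> cball 0 e" using e(1) by simp
  then obtain c y where cy: "(e / norm z) *\<^sub>R z = c + y" "c \<in> convex hull (v ` J)" "y \<in> polar_cone V"
    using e(2) by (meson set_plus_elim subsetD)
  show "\<exists>j\<in>J. v j \<bullet> z > 0"
  proof (rule ccontr)
    assume "\<not> ?thesis"
    then have "v ` J \<subseteq> {x. z \<bullet> x \<le> 0}" by (force simp: inner_commute)
    then have "convex hull (v ` J) \<subseteq> {x. z \<bullet> x \<le> 0}"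
      by (rule hull_minimal) (rule convex_halfspace_le)
    then have "c \<bullet> z \<le> 0" using cy(2) by (auto simp: inner_commute)
    moreover have "y \<bullet> z \<le> 0" using cy(3) z(1) by (auto simp: polar_cone_def)
    ultimately have "(c + y) \<bullet> z \<le> 0" by (simp add: inner_add_left)
    then have "e / norm z * (z \<bullet> z) \<le> 0" using cy(1) by (metis inner_scaleR_left)
    moreover have "e / norm z * (z \<bullet> z) > 0" using e(1) z(2) by simp
    ultimately show False by linarith
  qed
next
  assume pos: "\<forall>z\<in>V. z \<noteq> 0 \<longrightarrow> (\<exists>j\<in>J. v j \<bullet> z > 0)"
  obtain r where r: "r > 0" "\<And>x. x \<in> V \<Longrightarrow> \<exists>j\<in>J. r * norm x \<le> v j \<bullet> x"
    using pos_imp_linear_growth[OF J V(2,4), of v] pos by metis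
  let ?D = "convex hull (v ` J) + polar_cone V"
  have polar: "polar_cone V = (\<Inter>x\<in>V. {y. x \<bullet> y \<le> 0})"
    by (auto simp: polar_cone_def inner_commute)
  have conv: "convex ?D"
    unfolding polar by (intro convex_set_plus convex_convex_hull convex_INT convex_halfspace_le)
  \<comment> \<open>Strict separation calls for a closed sum; a compact set plus a closed set is
    closed.\<close>
  have "closed (polar_cone V)"
    unfolding polar by (intro closed_INT ballI closed_halfspace_le)
  moreover have "compact (convex hull (v ` J))"
    using J(1) by (simp add: finite_imp_compact_convex_hull)
  ultimately have "closed (\<Union>x\<in>convex hull (v ` J). \<Union>y\<in>polar_cone V. {x + y})"
    by (intro compact_closed_sums)
  also have "(\<Union>x\<in>convex hull (v ` J). \<Union>y\<in>polar_cone V. {x + y}) = ?D"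
    by (auto simp: set_plus_def)
  finally have clo: "closed ?D" .
  have "ball 0 r \<subseteq> ?D"
  proof
    fix u :: 'a assume u: "u \<in> ball 0 r"
    show "u \<in> ?D"
    proof (rule ccontr)
      assume "u \<notin> ?D"
      then obtain w b where w: "w \<bullet> u < b" "\<forall>x\<in>?D. b < w \<bullet> x"
        using separating_hyperplane_closed_point[OF conv clo] by blast
      have wD: "b < w \<bullet> v j + w \<bullet> y" if "j \<in> J" "y \<in> polar_cone V" for j y
        using w(2) that by (metis hull_inc imageI inner_add_right set_plus_intro)
      have "(- w) \<bullet> y \<le> 0" if y: "y \<in> polar_cone V" for y
      proof (rule ccontr)
        assume "\<not> ?thesis"
        then have neg: "w \<bullet> y < 0" by simp
        obtain j where j: "j \<in> J" using J(2) by blast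
        \<comment> \<open>Adding \<open>t *\<^sub>R y\<close> moves \<open>w \<bullet> v j\<close>
          down by \<open>\<bar>b - w \<bullet> v j\<bar>\<close>, hence to at most
          \<open>b\<close>.\<close>
        define t where "t = \<bar>b - w \<bullet> v j\<bar> / - (w \<bullet> y)"
        have "t \<ge> 0" using neg by (simp add: t_def divide_nonneg_pos del: divide_minus_right)
        then have "t *\<^sub>R y \<in> polar_cone V"
          using y by (simp add: polar_cone_def mult_nonneg_nonpos)
        then have "b < w \<bullet> v j + t * (w \<bullet> y)" using wD[OF j] by fastforce
        also have "t * (w \<bullet> y) = - \<bar>b - w \<bullet> v j\<bar>" using neg by (simp add: t_def)
        finally show False by linarith
      qed
      then have "- w \<in> V" by (rule polar_polar_subset[OF V])
      then obtain j where j: "j \<in> J" "r * norm (- w) \<le> v j \<bullet> (- w)" using r(2) by blast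
      \<comment> \<open>This yields \<open>r * norm w \<le> - (v j \<bullet> w) < - b < - (w
        \<bullet> u)\<close>, whereas Cauchy-Schwarz bounds the last term by
        \<open>r * norm w\<close>.\<close>
      have "b < w \<bullet> v j" using wD[OF j(1), of 0] by (simp add: polar_cone_def)
      then have "r * norm w < - (w \<bullet> u)" using j(2) w(1) by (simp add: inner_commute)
      also have "\<dots> \<le> norm w * norm u" using Cauchy_Schwarz_ineq2[of w u] by linarith
      also have "\<dots> \<le> norm w * r" using u by (intro mult_left_mono) auto
      finally show False by (simp add: mult.commute)
    qed
  qed
  then show "0 \<in> interior ?D" using r(1) by (auto simp: mem_interior)
qed

section \<open>Error bounds for single pieces, and recession directions of finite unions\<close>

text \<open>Linear growth controls the distance to a fixed point of \<open>Q\<close> up to an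
  additive constant \<open>B\<close>, which the lower bound \<open>m\<close> absorbs through
  \<open>B \<le> h x * (B / m)\<close>.\<close>

lemma norm_dist_bound_linear_growth:
  fixes h :: "'a::euclidean_space \<Rightarrow> real"
  assumes N: "is_norm N" and "Q \<noteq> {}" and "m > 0" "\<And>x. m \<le> h x"
    and "r > 0" "A \<ge> 0" "\<And>x. x \<in> V \<Longrightarrow> r * norm x - A \<le> h x"
  shows "\<exists>\<tau>>0. \<forall>x\<in>V. \<tau> * norm_dist N x Q \<le> h x"
proof -
  obtain q where q: "q \<in> Q" using \<open>Q \<noteq> {}\<close> by blast
  obtain K where K: "K > 0" "\<And>x. N x \<le> K * norm x" using is_norm_le_norm[OF N] by blast
  define B where "B = A + r * norm q"
  have B: "B \<ge> 0" using assms by (simp add: B_def)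
  \<comment> \<open>\<open>K\<close> pays for passing from \<open>N\<close> to \<open>norm\<close>,
    \<open>1 + B / m\<close> for absorbing \<open>B\<close>.\<close>
  define \<tau> where "\<tau> = r / (K * (1 + B / m))"
  have pos: "1 + B / m > 0" using B \<open>m > 0\<close> by (simp add: add_pos_nonneg)
  have "\<tau> * norm_dist N x Q \<le> h x" if x: "x \<in> V" for x
  proof -
    have "norm_dist N x Q \<le> N (x - q)" by (rule norm_dist_le[OF N q])
    also have "\<dots> \<le> K * norm (x - q)" by (rule K)
    also have "\<dots> \<le> K * (norm x + norm q)"
      using K(1) by (intro mult_left_mono norm_triangle_ineq4) auto
    finally have "\<tau> * norm_dist N x Q \<le> \<tau> * (K * (norm x + norm q))"
      using K(1) \<open>r > 0\<close> pos by (intro mult_left_mono) (auto simp: \<tau>_def)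
    also have "\<dots> = r * (norm x + norm q) / (1 + B / m)" using K(1) by (simp add: \<tau>_def)
    also have "\<dots> \<le> h x"
    proof -
      have "r * (norm x + norm q) \<le> h x + B" using assms(7)[OF x] by (simp add: B_def algebra_simps)
      also have "B \<le> h x * (B / m)"
        using mult_right_mono[OF assms(4)[of x], of "B / m"] B \<open>m > 0\<close> by simp
      finally show ?thesis using pos by (simp add: pos_divide_le_eq distrib_left)
    qed
    finally show ?thesis .
  qed
  moreover have "\<tau> > 0" using pos K(1) \<open>r > 0\<close> by (simp add: \<tau>_def)
  ultimately show ?thesis by blast
qed

text \<open>The infimum lives in \<open>ereal\<close> because a piece may be unbounded below;
  density yields a real \<open>m\<close> strictly between 0 and it.\<close>

lemma INF_ereal_pos_imp_lower_bound:
  assumes "(INF x. ereal (h x)) > 0"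
  obtains m where "m > 0" "\<And>x. m \<le> h x"
proof -
  obtain m where m: "0 < ereal m" "ereal m < (INF x. ereal (h x))"
    using ereal_dense2[OF assms] by blast
  have "m \<le> h x" for x
    using less_le_trans[OF m(2) INF_lower[of x UNIV "\<lambda>x. ereal (h x)"]] by simp
  then show ?thesis using that m(1) by simp
qed

lemma INF_ereal_nonpos_imp_small_value:
  assumes "\<not> (INF x. ereal (h x)) > 0" "e > 0"
  shows "\<exists>x. h x < e"
proof -
  have "(INF x. ereal (h x)) < ereal e" using assms by (simp add: not_less le_less_trans)
  then show ?thesis by (auto simp: INF_less_iff)
qed

text \<open>\<open>Q\<close> contains the zero sublevel set of the piece, so a Hoffman bound for
  that set passes to \<open>Q\<close>. If the infimum is positive, that set is empty and linear
  growth on \<open>V\<close> takes over.\<close>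

lemma max_affine_norm_dist_bound:
  fixes v :: "'i \<Rightarrow> 'a::euclidean_space"
  assumes N: "is_norm N" and J: "finite J" "J \<noteq> {}" and V: "closed V" "cone V"
    and Q: "Q \<noteq> {}" "\<And>x. max_affine a v J x \<le> 0 \<Longrightarrow> x \<in> Q"
    and pos: "(INF x. ereal (max_affine a v J x)) > 0 \<Longrightarrow>
      \<forall>z\<in>V. z \<noteq> 0 \<longrightarrow> (\<exists>j\<in>J. v j \<bullet> z > 0)"
  shows "\<exists>\<tau>>0. \<forall>x\<in>V. \<tau> * norm_dist N x Q \<le> max (max_affine a v J x) 0"
proof (cases "(INF x. ereal (max_affine a v J x)) > 0")
  case True
  obtain m where m: "m > 0" "\<And>x. m \<le> max_affine a v J x"
    using INF_ereal_pos_imp_lower_bound[OF True] by blast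
  obtain r where r: "r > 0" "\<And>x. x \<in> V \<Longrightarrow> \<exists>j\<in>J. r * norm x \<le> v j \<bullet> x"
    using pos_imp_linear_growth[OF J V, of v] pos[OF True] by metis
  obtain A where A: "A \<ge> 0" "\<And>x. x \<in> V \<Longrightarrow> r * norm x - A \<le> max_affine a v J x"
    using max_affine_ge_linear_growth[OF J r(2)] by metis
  show ?thesis
    using norm_dist_bound_linear_growth[OF N Q(1) m r(1) A] by (meson max.coboundedI1)
next
  case False
  obtain c where c: "c > 0"
    "\<And>x. \<exists>y. max_affine a v J y \<le> 0 \<and> c * norm (x - y) \<le> max (max_affine a v J x) 0"
    using max_affine_error_bound[OF J INF_ereal_nonpos_imp_small_value[OF False]] by blast
  obtain K where K: "K > 0" "\<And>x. N x \<le> K * norm x" using is_norm_le_norm[OF N] by blast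
  have "c / K * norm_dist N x Q \<le> max (max_affine a v J x) 0" for x
  proof -
    obtain y where y: "max_affine a v J y \<le> 0" "c * norm (x - y) \<le> max (max_affine a v J x) 0"
      using c(2) by blast
    have "norm_dist N x Q \<le> K * norm (x - y)"
      using norm_dist_le[OF N Q(2)[OF y(1)]] K(2) by (rule order_trans)
    then have "c / K * norm_dist N x Q \<le> c / K * (K * norm (x - y))"
      using c(1) K(1) by (intro mult_left_mono) auto
    then show ?thesis using y(2) K(1) by simp
  qed
  then show ?thesis using c(1) K(1) by (intro exI[of _ "c / K"]) auto
qed

text \<open>Infinitely many of the points \<open>y\<close> near \<open>n z\<close> lie in the same piece, so letting \<open>n\<close> tend to
  infinity shows that \<open>z\<close> is a recession direction of that piece.\<close>

lemma recession_cone_of_bounded_dist_ray: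
  fixes v :: "'k \<Rightarrow> 'i \<Rightarrow> 'a::euclidean_space"
  assumes "finite I" and J: "\<And>k. k \<in> I \<Longrightarrow> finite (J k) \<and> J k \<noteq> {}"
    and S: "\<And>x. x \<in> S \<longleftrightarrow> (\<exists>k\<in>I. max_affine (a k) (v k) (J k) x \<le> 0)"
    and near: "\<And>n::nat. \<exists>y\<in>S. norm (real n *\<^sub>R z - y) \<le> M"
  shows "z \<in> recession_cone S"
proof -
  obtain y where y: "\<And>n. y n \<in> S" "\<And>n::nat. norm (real n *\<^sub>R z - y n) \<le> M"
    using near by metis
  obtain k where k: "\<And>n. k n \<in> I" "\<And>n. max_affine (a (k n)) (v (k n)) (J (k n)) (y n) \<le> 0"
    using y(1) unfolding S by metis
  have "finite (range k)" using k(1) \<open>finite I\<close> by (meson finite_subset image_subsetI)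
  then obtain n0 where inf: "infinite {n. k n = k n0}"
    using pigeonhole_infinite[of UNIV k] by auto
  define p where "p = k n0"
  have p: "p \<in> I" using k(1) by (simp add: p_def)
  have dir: "v p j \<bullet> z \<le> 0" if j: "j \<in> J p" for j
  proof (rule ccontr)
    assume "\<not> ?thesis"
    then have pos: "v p j \<bullet> z > 0" by simp
    \<comment> \<open>Whenever \<open>k n = p\<close>, Cauchy-Schwarz bounds
      \<open>n * (v p j \<bullet> z)\<close> by \<open>norm (v p j) * M - a p j\<close>; a positive
      slope exceeds this from \<open>m\<close> on.\<close>
    obtain m where m: "(norm (v p j) * M - a p j) / (v p j \<bullet> z) < real m" using reals_Archimedean2 by blast
    obtain n where n: "n \<ge> m" "k n = p" using inf by (auto simp: infinite_nat_iff_unbounded_le p_def)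
    have "a p j + v p j \<bullet> y n \<le> 0"
      using k(2)[of n] n(2) max_affine_ge[of "J p" j "a p" "v p" "y n"] J[OF p] j by auto
    moreover have "v p j \<bullet> (real n *\<^sub>R z - y n) \<le> norm (v p j) * M"
      using norm_cauchy_schwarz[of "v p j" "real n *\<^sub>R z - y n"] mult_left_mono[OF y(2)[of n], of "norm (v p j)"]
      by simp
    ultimately have "real n * (v p j \<bullet> z) \<le> norm (v p j) * M - a p j"
      by (simp add: inner_diff_right)
    moreover have "norm (v p j) * M - a p j < real n * (v p j \<bullet> z)"
    proof -
      have "norm (v p j) * M - a p j < real m * (v p j \<bullet> z)" using m pos by (simp add: pos_divide_less_eq)
      also have "\<dots> \<le> real n * (v p j \<bullet> z)" using n(1) pos by simp
      finally show ?thesis .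
    qed
    ultimately show False by linarith
  qed
  \<comment> \<open>The recession cone asks for a single base point; \<open>y n0\<close> lies in
    piece \<open>p\<close>, none of whose affine functions increases along \<open>z\<close>.\<close>
  have "y n0 + t *\<^sub>R z \<in> S" if t: "t \<ge> 0" for t
  proof -
    have "a p j + v p j \<bullet> (y n0 + t *\<^sub>R z) \<le> 0" if "j \<in> J p" for j
    proof -
      have "t * (v p j \<bullet> z) \<le> 0" using dir[OF that] t by (simp add: mult_nonneg_nonpos)
      then show ?thesis
        using k(2)[of n0] max_affine_ge[of "J p" j "a p" "v p" "y n0"] J[OF p] that
        by (simp add: p_def inner_add_right)
    qed
    then have "max_affine (a p) (v p) (J p) (y n0 + t *\<^sub>R z) \<le> 0"
      using J[OF p] by (simp add: max_affine_le_iff)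
    then show ?thesis using S p by blast
  qed
  then show ?thesis using y(1) by (auto simp: recession_cone_def)
qed

section \<open>Equivalence, sufficiency and necessity for the min-max form\<close>

theorem theorem8:
  fixes N :: "'a::euclidean_space \<Rightarrow> real"
    and f :: "'a \<Rightarrow> real"
    and fi :: "nat \<Rightarrow> 'a \<Rightarrow> real"
    and a :: "nat \<Rightarrow> nat \<Rightarrow> real"
    and v :: "nat \<Rightarrow> nat \<Rightarrow> 'a"
    and l :: nat
    and s :: "nat \<Rightarrow> nat"
    and V :: "'a set"
  assumes "is_norm N"
    and "piecewise_affine f"
    and "l \<ge> 1"
    and "\<And>i. i \<in> {1..l} \<Longrightarrow> s i \<ge> 1"
    and "\<And>i x. i \<in> {1..l} \<Longrightarrow> fi i x = Max ((\<lambda>j. a i j + v i j \<bullet> x) ` {1..s i})"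
    and "\<And>x. f x = Min ((\<lambda>i. fi i x) ` {1..l})"
    and "sublevel0 f \<noteq> {}"
    and "V \<noteq> {}" and "closed V" and "convex V" and "cone V"
  shows "(\<forall>i\<in>{1..l}. (INF x. ereal (fi i x)) > 0 \<longrightarrow>
            (coercive_on N (fi i) V \<longleftrightarrow>
             0 \<in> interior (convex hull (v i ` {1..s i}) + polar_cone V)))
       \<and> ((\<forall>i\<in>{1..l}. (INF x. ereal (fi i x)) > 0 \<longrightarrow>
             coercive_on N (fi i) V \<or>
             0 \<in> interior (convex hull (v i ` {1..s i}) + polar_cone V))
          \<longrightarrow> has_error_bound_on N f V)
       \<and> (recession_cone (sublevel0 f) \<inter> V = {0} \<longrightarrow>
            has_error_bound_on N f V \<longrightarrow>
            (\<forall>i\<in>{1..l}. (INF x. ereal (fi i x)) > 0 \<longrightarrow>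
               coercive_on N (fi i) V \<and>
               0 \<in> interior (convex hull (v i ` {1..s i}) + polar_cone V)))"
proof -
  define J where "J i = {1..s i}" for i
  have J: "finite (J i)" "J i \<noteq> {}" if "i \<in> {1..l}" for i
    using assms(4)[OF that] by (auto simp: J_def)
  have fi: "fi i = max_affine (a i) (v i) (J i)" if "i \<in> {1..l}" for i
    using assms(5)[OF that] by (simp add: fun_eq_iff max_affine_def J_def)
  have f_le: "f x \<le> fi i x" if "i \<in> {1..l}" for i x
    using that by (simp add: assms(6))
  have f_attained: "\<exists>i\<in>{1..l}. f x = fi i x" for x
  proof -
    have "f x \<in> (\<lambda>i. fi i x) ` {1..l}"
      unfolding assms(6) using \<open>l \<ge> 1\<close> by (intro Min_in) auto
    then show ?thesis by blast
  qed
  \<comment> \<open>\<open>S(f)\<close> is the finite union of the zero sublevel sets of the pieces,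
    since the minimum is attained by one of them.\<close>
  have S: "x \<in> sublevel0 f \<longleftrightarrow> (\<exists>i\<in>{1..l}. max_affine (a i) (v i) (J i) x \<le> 0)" for x
    using f_attained[of x] f_le[of _ x] fi unfolding sublevel0_def by (metis mem_Collect_eq order_trans)
  \<comment> \<open>The common condition to which coercivity and interiority both reduce.\<close>
  let ?P = "\<lambda>i. \<forall>z\<in>V. z \<noteq> 0 \<longrightarrow> (\<exists>j\<in>J i. v i j \<bullet> z > 0)"
  have coercive: "coercive_on N (fi i) V \<longleftrightarrow> ?P i" if "i \<in> {1..l}" for i
    unfolding fi[OF that] by (rule coercive_on_max_affine_iff) (use assms J that in auto)
  have interior: "0 \<in> interior (convex hull (v i ` {1..s i}) + polar_cone V) \<longleftrightarrow> ?P i"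
    if "i \<in> {1..l}" for i
    unfolding J_def[symmetric]
    by (rule zero_in_interior_hull_plus_polar_iff) (use assms J that in auto)
  have sufficient: "has_error_bound_on N f V"
    if pos: "\<forall>i\<in>{1..l}. (INF x. ereal (fi i x)) > 0 \<longrightarrow> ?P i"
  proof -
    have "\<exists>\<tau>>0. \<forall>x\<in>V. \<tau> * norm_dist N x (sublevel0 f) \<le> max (fi i x) 0" if i: "i \<in> {1..l}" for i
      unfolding fi[OF i]
    proof (rule max_affine_norm_dist_bound[OF assms(1) J[OF i] assms(9,11,7)])
      show "x \<in> sublevel0 f" if "max_affine (a i) (v i) (J i) x \<le> 0" for x
        using that i S by blast
      show "?P i" if "(INF x. ereal (max_affine (a i) (v i) (J i) x)) > 0"
        using that pos i unfolding fi[OF i, symmetric] by blast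
    qed
    then obtain \<tau> where \<tau>: "\<And>i. i \<in> {1..l} \<Longrightarrow> \<tau> i > 0"
      "\<And>i x. i \<in> {1..l} \<Longrightarrow> x \<in> V \<Longrightarrow> \<tau> i * norm_dist N x (sublevel0 f) \<le> max (fi i x) 0"
      by metis
    \<comment> \<open>The smallest constant works at every \<open>x\<close>, through the piece
      attaining the minimum there.\<close>
    define \<tau>0 where "\<tau>0 = Min (\<tau> ` {1..l})"
    have "\<tau>0 > 0" using \<tau>(1) \<open>l \<ge> 1\<close> by (simp add: \<tau>0_def)
    moreover have "\<tau>0 * norm_dist N x (sublevel0 f) \<le> max (f x) 0" if x: "x \<in> V" for x
    proof -
      obtain i where i: "i \<in> {1..l}" "f x = fi i x" using f_attained by blast
      have "\<tau>0 \<le> \<tau> i" using i(1) by (simp add: \<tau>0_def)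
      then have "\<tau>0 * norm_dist N x (sublevel0 f) \<le> \<tau> i * norm_dist N x (sublevel0 f)"
        by (intro mult_right_mono norm_dist_nonneg assms)
      then show ?thesis using \<tau>(2)[OF i(1) x] i(2) by simp
    qed
    ultimately show ?thesis by (auto simp: has_error_bound_on_def)
  qed
  have necessary: "?P i"
    if rec: "recession_cone (sublevel0 f) \<inter> V = {0}" and eb: "has_error_bound_on N f V"
      and i: "i \<in> {1..l}" for i
  proof (rule ccontr)
    assume "\<not> ?P i"
    then obtain z where z: "z \<in> V" "z \<noteq> 0" "\<And>j. j \<in> J i \<Longrightarrow> v i j \<bullet> z \<le> 0" by force
    obtain A where A: "A \<ge> 0" "\<And>t. t \<ge> 0 \<Longrightarrow> fi i (t *\<^sub>R z) \<le> A"
      using max_affine_bounded_on_ray[OF J[OF i], of "v i" z "a i"] z(3) fi[OF i] by metis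
    obtain \<tau> where \<tau>: "\<tau> > 0" "\<forall>x\<in>V. \<tau> * norm_dist N x (sublevel0 f) \<le> max (f x) 0"
      using eb by (auto simp: has_error_bound_on_def)
    obtain K where K: "K > 0" "\<And>x. norm x \<le> K * N x" using norm_le_is_norm[OF assms(1)] by blast
    \<comment> \<open>On the ray \<open>f \<le> fi i \<le> A\<close>, so the error bound caps the
      distance at \<open>A / \<tau>\<close>; the \<open>+ 1\<close> is slack for choosing an actual
      point \<open>y\<close>, and \<open>K\<close> returns to \<open>norm\<close>.\<close>
    have near: "\<exists>y\<in>sublevel0 f. norm (real n *\<^sub>R z - y) \<le> K * (A / \<tau> + 1)" for n
    proof -
      have "real n *\<^sub>R z \<in> V" using z(1) \<open>cone V\<close> by (simp add: cone_def)
      then have "\<tau> * norm_dist N (real n *\<^sub>R z) (sublevel0 f) \<le> max (f (real n *\<^sub>R z)) 0"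
        using \<tau>(2) by blast
      also have "\<dots> \<le> A" using f_le[OF i, of "real n *\<^sub>R z"] A(2)[of "real n"] A(1) by simp
      finally have "norm_dist N (real n *\<^sub>R z) (sublevel0 f) < A / \<tau> + 1"
        using \<tau>(1) by (simp add: field_simps)
      then obtain y where y: "y \<in> sublevel0 f" "N (real n *\<^sub>R z - y) < A / \<tau> + 1"
        using norm_dist_approx[OF assms(7)] by blast
      have "norm (real n *\<^sub>R z - y) \<le> K * N (real n *\<^sub>R z - y)" by (rule K)
      also have "\<dots> \<le> K * (A / \<tau> + 1)" using K(1) y(2) by (intro mult_left_mono) auto
      finally show ?thesis using y(1) by blast
    qed
    have "z \<in> recession_cone (sublevel0 f)"
      by (rule recession_cone_of_bounded_dist_ray[where I = "{1..l}" and J = J, OF _ _ S near])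
        (use J in auto)
    then show False using rec z(1,2) by blast
  qed
  show ?thesis
    using coercive interior sufficient necessary by blast
qed

end
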